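(* Let $\lambda$ be a partition, $N=|\lambda|$, $\ell=\ell(\lambda)$, and let $\Psi^{(\lambda)}(x,y,z)$ be the semi-stationary wave function of the point $W^{(\lambda)}$ of the adelic Grassmannian. Then $$\Psi^{(\lambda)}(x,y,z)=\sum_{m\in\mathcal J^{(\lambda)}}\frac{\kappa^{(\lambda)}(m)}{(m+\ell)!}\,R^{(\lambda)}_m(x,y)\,z^m=\sum_{m=-\ell}^{\infty}\frac{\kappa^{(\lambda)}(m)}{(m+\ell)!}\,R^{(\lambda)}_m(x,y)\,z^m,$$ $$z^N\tau^{(\lambda)}(x,y)\,\Psi^{(\lambda)}(x,y,z)=\sum_{n\in\mathcal I^{(\lambda)}}\frac{\kappa^{(\lambda)}_N(n)}{n!}\,H^{(\lambda)}_n(x,y)\,z^n=\sum_{n=0}^{\infty}\frac{\kappa^{(\lambda)}_N(n)}{n!}\,H^{(\lambda)}_n(x,y)\,z^n .$$ In the second and fourth sums, the terms with $m\notin\mathcal J^{(\lambda)}$, respectively $n\notin\mathcal I^{(\lambda)}$, are understood to be $0$ (for these indices the coefficient $\kappa^{(\lambda)}(m)$, respectively $\kappa^{(\lambda)}_N(n)$, vanishes).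
   Context: A partition $\lambda$ is a sequence of non-negative integers $\lambda_1\ge\lambda_2\ge\cdots$ with $|\lambda|=\sum_i\lambda_i<\infty$; $\ell(\lambda)$ is the number of nonzero entries. Put $m_i=\lambda_i-i$ ($i\ge1$), $\mathcal M^{(\lambda)}=\{m_i: i\ge 1\}\subset\mathbb Z$, $\mathcal J^{(\lambda)}=\mathbb Z\setminus\mathcal M^{(\lambda)}$ (all its elements are $\ge-\ell$), $\mathcal I^{(\lambda)}=\mathcal J^{(\lambda)}+N$. Put $k_i=m_i+\ell$ for $1\le i\le\ell$, so $k_1>\dots>k_\ell>0$, and $\mathcal K^{(\lambda)}=\{k_1,\dots,k_\ell\}$. Polynomials in $m$, $n$: $\kappa^{(\lambda)}(m)=\prod_{i=1}^{\ell}(m-m_i)$ and $\kappa^{(\lambda)}_N(n)=\prod_{i=1}^{N}(n-m_i-N)$. Bivariate Hermite polynomials: $e^{xz+yz^2}=\sum_{n\ge0}H_n(x,y)z^n/n!$. $\mathrm{Wr}$ denotes the Wronskian determinant with respect to $x$. Set $$\tau^{(\lambda)}=\frac{\mathrm{Wr}[H_{k_\ell},\dots,H_{k_1}]}{\prod_{i<j}(k_i-k_j)},\qquad H^{(\lambda)}_n=\frac{\mathrm{Wr}[H_{k_\ell},\dots,H_{k_1},H_{n-N+\ell}]}{\prod_{i<j}(k_i-k_j)\prod_{i=1}^{\ell}(n-N+\ell-k_i)}\ (n\in\mathcal I^{(\lambda)}),\qquad R^{(\lambda)}_m=\frac{H^{(\lambda)}_{m+N}}{\tau^{(\lambda)}}\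 (m\in\mathcal J^{(\lambda)}).$$ The $H^{(\lambda)}_n$ are the (bivariate) exceptional Hermite polynomials. Wave function: let $C^{(\lambda)}$ be the span of the functionals $c_i: f\mapsto f^{(k_i)}(0)$, $i=1,\dots,\ell$, on polynomials $f(z)$. Then $W^{(\lambda)}:=\mathrm{span}\{z^m:m\in\mathcal J^{(\lambda)}\}=z^{-\ell}\ker C^{(\lambda)}$ is a point of the adelic Grassmannian. With $\psi_0(t_1,t_2,\dots;z)=\exp(\sum_{k\ge1}t_kz^k)$ and $\phi_i=\langle c_i(z),\psi_0(t;z)\rangle$ (the functional acting in the variable $z$), the dynamical wave function is $$\psi_{W^{(\lambda)}}(t;z)=\frac{\mathrm{Wr}_{t_1}[\phi_1,\dots,\phi_\ell,\psi_0]}{z^\ell\,\mathrm{Wr}_{t_1}[\phi_1,\dots,\phi_\ell]},$$ and the semi-stationary wave function is $\Psi^{(\lambda)}(x,y,z)=\psi_{W^{(\lambda)}}(x,y,0,0,\dots;z)$. The expansions are Laurent expansions in $z$ at $z=0$. *)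

theory Defs
  imports "HOL-Complex_Analysis.Complex_Analysis" "Jordan_Normal_Form.Determinant"
begin

section \<open>Partitions and Maya diagrams\<close>

text \<open>A partition is a function \<open>lam :: nat \<Rightarrow> nat\<close> with parts \<open>lam 1 \<ge> lam 2 \<ge> \<dots>\<close>; the value \<open>lam 0\<close>
  is never used.  A sequence of naturals has a finite sum iff it has finitely many nonzero terms.\<close>

definition is_partition :: "(nat \<Rightarrow> nat) \<Rightarrow> bool" where
  "is_partition lam \<longleftrightarrow> (\<forall>i\<ge>1. lam (Suc i) \<le> lam i) \<and> finite {i. 1 \<le> i \<and> lam i \<noteq> 0}"

definition part_size :: "(nat \<Rightarrow> nat) \<Rightarrow> nat" where
  "part_size lam = (\<Sum>i | 1 \<le> i \<and> lam i \<noteq> 0. lam i)"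

definition part_length :: "(nat \<Rightarrow> nat) \<Rightarrow> nat" where
  "part_length lam = card {i. 1 \<le> i \<and> lam i \<noteq> 0}"

definition maya :: "(nat \<Rightarrow> nat) \<Rightarrow> nat \<Rightarrow> int" where
  "maya lam i = int (lam i) - int i"

definition M_set :: "(nat \<Rightarrow> nat) \<Rightarrow> int set" where
  "M_set lam = {maya lam i | i. 1 \<le> i}"

definition J_set :: "(nat \<Rightarrow> nat) \<Rightarrow> int set" where
  "J_set lam = UNIV - M_set lam"

definition I_set :: "(nat \<Rightarrow> nat) \<Rightarrow> int set" where
  "I_set lam = (\<lambda>m. m + int (part_size lam)) ` J_set lam"

text \<open>Only used for \<open>1 \<le> i \<le> part_length lam\<close>, where the integer is positive and \<open>nat\<close> loses nothing.\<close>

definition k_idx :: "(nat \<Rightarrow> nat) \<Rightarrow> nat \<Rightarrow> nat" where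
  "k_idx lam i = nat (maya lam i + int (part_length lam))"

definition kappa :: "(nat \<Rightarrow> nat) \<Rightarrow> int \<Rightarrow> int" where
  "kappa lam m = (\<Prod>i = 1..part_length lam. m - maya lam i)"

definition kappa_N :: "(nat \<Rightarrow> nat) \<Rightarrow> int \<Rightarrow> int" where
  "kappa_N lam n = (\<Prod>i = 1..part_size lam. n - maya lam i - int (part_size lam))"


section \<open>Wronskians\<close>

definition wronskian :: "(complex \<Rightarrow> complex) list \<Rightarrow> complex \<Rightarrow> complex" where
  "wronskian fs x =
     Determinant.det (Matrix.mat (length fs) (length fs) (\<lambda>(i, j). (deriv ^^ i) (fs ! j) x))"

text \<open>The Wronskian with respect to the first of the times \<open>t 1, t 2, \<dots>\<close>; the value \<open>t 0\<close> is unused.\<close>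

definition wronskian_t1 :: "((nat \<Rightarrow> complex) \<Rightarrow> complex) list \<Rightarrow> (nat \<Rightarrow> complex) \<Rightarrow> complex" where
  "wronskian_t1 fs t = wronskian (map (\<lambda>f s. f (t(1 := s))) fs) (t 1)"


section \<open>Exceptional Hermite polynomials\<close>

text \<open>\<open>hermite n x y / n!\<close> is the coefficient of \<open>z\<^sup>n\<close> in \<open>exp (x z + y z\<^sup>2)\<close>.\<close>

definition hermite :: "nat \<Rightarrow> complex \<Rightarrow> complex \<Rightarrow> complex" where
  "hermite n x y = fact n * fps_nth (fps_expansion (\<lambda>z. exp (x * z + y * z ^ 2)) 0) n"

lemma hermite_generating_function:
  "(\<lambda>n. hermite n x y * z ^ n / fact n) sums exp (x * z + y * z ^ 2)"
proof -
  let ?f = "\<lambda>z::complex. exp (x * z + y * z ^ 2)"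
  have "?f holomorphic_on ball 0 (norm z + 1)"
    by (intro holomorphic_intros)
  then have "(\<lambda>n. (deriv ^^ n) ?f 0 / fact n * (z - 0) ^ n) sums ?f z"
    by (rule holomorphic_power_series) simp
  then show ?thesis
    by (simp add: hermite_def fps_expansion_def)
qed

definition vandermonde_k :: "(nat \<Rightarrow> nat) \<Rightarrow> complex" where
  "vandermonde_k lam = (\<Prod>i = 1..part_length lam. \<Prod>j = Suc i..part_length lam.
     of_nat (k_idx lam i) - of_nat (k_idx lam j))"

text \<open>The list \<open>H\<^bsub>k\<^sub>\<ell>\<^esub>, \<dots>, H\<^bsub>k\<^sub>1\<^esub>\<close> as functions of \<open>x\<close>.\<close>

definition hermite_seed :: "(nat \<Rightarrow> nat) \<Rightarrow> complex \<Rightarrow> (complex \<Rightarrow> complex) list" where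
  "hermite_seed lam y = map (\<lambda>i x. hermite (k_idx lam i) x y) (rev [1..<Suc (part_length lam)])"

definition tau :: "(nat \<Rightarrow> nat) \<Rightarrow> complex \<Rightarrow> complex \<Rightarrow> complex" where
  "tau lam x y = wronskian (hermite_seed lam y) x / vandermonde_k lam"

text \<open>Only meaningful for \<open>n \<in> I_set lam\<close>; then \<open>n - N + \<ell>\<close> is nonnegative and differs from all \<open>k\<^sub>i\<close>.\<close>

definition exc_hermite :: "(nat \<Rightarrow> nat) \<Rightarrow> int \<Rightarrow> complex \<Rightarrow> complex \<Rightarrow> complex" where
  "exc_hermite lam n x y =
     (let r = n - int (part_size lam) + int (part_length lam) in
      wronskian (hermite_seed lam y @ [\<lambda>x. hermite (nat r) x y]) x /
      (vandermonde_k lam * (\<Prod>i = 1..part_length lam. of_int r - of_nat (k_idx lam i))))"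

definition R_fun :: "(nat \<Rightarrow> nat) \<Rightarrow> int \<Rightarrow> complex \<Rightarrow> complex \<Rightarrow> complex" where
  "R_fun lam m x y = exc_hermite lam (m + int (part_size lam)) x y / tau lam x y"


section \<open>Wave functions\<close>

text \<open>The point \<open>W\<close> is a space of Laurent polynomials.  It is presented as \<open>z\<^bsup>-\<ell>\<^esup> ker C\<close>, where \<open>C\<close>
  is spanned by the functionals \<open>c\<^sub>i\<close>.  These are defined on all functions, so that they
  apply to polynomials and to the entire function \<open>\<psi>\<^sub>0\<close> alike.\<close>

definition cond :: "(nat \<Rightarrow> nat) \<Rightarrow> nat \<Rightarrow> (complex \<Rightarrow> complex) \<Rightarrow> complex" where
  "cond lam i f = (deriv ^^ k_idx lam i) f 0"

definition conds :: "(nat \<Rightarrow> nat) \<Rightarrow> ((complex \<Rightarrow> complex) \<Rightarrow> complex) list" where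
  "conds lam = map (cond lam) [1..<Suc (part_length lam)]"

definition ker_conds :: "((complex \<Rightarrow> complex) \<Rightarrow> complex) list \<Rightarrow> complex poly set" where
  "ker_conds cs = {p. \<forall>c\<in>set cs. c (poly p) = 0}"

definition W_point :: "(nat \<Rightarrow> nat) \<Rightarrow> complex fls set" where
  "W_point lam = Modules.module.span (\<lambda>c f. fls_const c * f) ((\<lambda>m. fls_X_intpow m) ` J_set lam)"

lemma part_support:
  assumes "is_partition lam"
  shows "{i. 1 \<le> i \<and> lam i \<noteq> 0} = {1..part_length lam}"
proof -
  define S where "S = {i. 1 \<le> i \<and> lam i \<noteq> 0}"
  have fin: "finite S" and dec: "\<And>i. i \<ge> 1 \<Longrightarrow> lam (Suc i) \<le> lam i"
    using assms by (auto simp: is_partition_def S_def)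
  have mono: "1 \<le> i \<Longrightarrow> i \<le> j \<Longrightarrow> lam j \<le> lam i" for i j
  proof (rotate_tac 1, induction j rule: dec_induct)
    case (step n)
    then show ?case using dec[of n] by simp
  qed simp
  have "S = {1..card S}"
  proof (cases "S = {}")
    case False
    define M where "M = Max S"
    have "M \<in> S" using False fin by (simp add: M_def)
    have "S = {1..M}"
    proof (intro equalityI subsetI)
      fix i assume "i \<in> S"
      then show "i \<in> {1..M}" using fin by (auto simp: S_def M_def)
    next
      fix i assume "i \<in> {1..M}"
      then show "i \<in> S" using mono[of i M] \<open>M \<in> S\<close> by (auto simp: S_def)
    qed
    then show ?thesis by (metis card_atLeastAtMost diff_Suc_1)
  qed simp
  then show ?thesis by (simp add: S_def part_length_def)
qed

lemma mem_J_set_shift: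
  assumes "is_partition lam"
  shows "m \<in> J_set lam \<longleftrightarrow>
    m \<ge> - int (part_length lam) \<and>
    nat (m + int (part_length lam)) \<notin> k_idx lam ` {1..part_length lam}"
proof -
  let ?l = "part_length lam"
  have pos: "lam i > 0" if "i \<in> {1..?l}" for i
    using that part_support[OF assms] by blast
  have zero: "lam i = 0" if "i > ?l" for i
  proof (rule ccontr)
    assume "lam i \<noteq> 0"
    then have "i \<in> {i. 1 \<le> i \<and> lam i \<noteq> 0}" using that by auto
    then have "i \<in> {1..?l}" by (simp only: part_support[OF assms])
    then show False using that by auto
  qed
  have ge: "maya lam i + int ?l > 0" if "i \<in> {1..?l}" for i
    using pos[OF that] that by (auto simp: maya_def)
  have "m \<in> M_set lam \<longleftrightarrow> m < - int ?l \<or> (\<exists>i\<in>{1..?l}. m = maya lam i)"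
  proof
    assume "m \<in> M_set lam"
    then obtain i where i: "1 \<le> i" "m = maya lam i" by (auto simp: M_set_def)
    then show "m < - int ?l \<or> (\<exists>i\<in>{1..?l}. m = maya lam i)"
      using zero[of i] by (cases "i \<le> ?l") (auto simp: maya_def)
  next
    assume "m < - int ?l \<or> (\<exists>i\<in>{1..?l}. m = maya lam i)"
    then show "m \<in> M_set lam"
    proof
      assume "m < - int ?l"
      then have "m = maya lam (nat (- m))" "1 \<le> nat (- m)"
        using zero[of "nat (- m)"] by (auto simp: maya_def)
      then show ?thesis by (auto simp: M_set_def)
    qed (auto simp: M_set_def)
  qed
  moreover have "m = maya lam i \<longleftrightarrow> nat (m + int ?l) = k_idx lam i"
    if "m \<ge> - int ?l" "i \<in> {1..?l}" for i
    using that ge[OF that(2)] by (auto simp: k_idx_def)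
  ultimately show ?thesis
    by (fastforce simp: J_set_def)
qed

lemma ker_conds_iff:
  "p \<in> ker_conds (conds lam) \<longleftrightarrow> (\<forall>i\<in>{1..part_length lam}. coeff p (k_idx lam i) = 0)"
proof -
  have der: "(deriv ^^ k) (poly p) = poly ((pderiv ^^ k) p)" for k
    by (induction k) (auto intro!: DERIV_imp_deriv poly_DERIV)
  have "(deriv ^^ k) (poly p) 0 = fact k * coeff p k" for k
    by (simp add: der poly_0_coeff_0 coeff_higher_pderiv pochhammer_fact)
  then show ?thesis
    by (simp add: ker_conds_def conds_def cond_def atLeastLessThanSuc_atLeastAtMost del: upt_Suc)
qed

lemma W_point_eq:
  assumes "is_partition lam"
  shows "W_point lam =
    {fls_X_intpow (- int (part_length lam)) * fps_to_fls (fps_of_poly p) | p. p \<in> ker_conds (conds lam)}"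
proof -
  let ?l = "part_length lam"
  interpret V: Modules.module "\<lambda>(c::complex) f. fls_const c * f"
    by unfold_locales
      (simp_all add: distrib_left distrib_right fls_plus_const [symmetric] mult.assoc [symmetric]
        fls_const_mult_const)
  define X :: "int \<Rightarrow> complex fls" where "X = (\<lambda>m. fls_X_intpow m)"
  define Q where "Q = (\<lambda>p. X (- int ?l) * fps_to_fls (fps_of_poly p))"
  have Q_nth: "fls_nth (Q p) m = (if m < - int ?l then 0 else coeff p (nat (m + int ?l)))" for p m
    unfolding Q_def X_def fls_X_intpow_times_conv_shift(1)
    by (auto simp: add.commute)
  have "W_point lam = V.span (X ` J_set lam)" by (simp add: W_point_def X_def)
  also have "\<dots> = Q ` ker_conds (conds lam)"
  proof (intro equalityI subsetI)
    fix f assume "f \<in> V.span (X ` J_set lam)"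
    then show "f \<in> Q ` ker_conds (conds lam)"
    proof (induction rule: V.span_induct_alt)
      case base
      have "Q 0 = 0" by (simp add: Q_def)
      then show ?case by (auto simp: ker_conds_iff image_iff intro!: bexI[of _ 0])
    next
      case (step c g f)
      then obtain m p where m: "m \<in> J_set lam" "g = X m" and p: "p \<in> ker_conds (conds lam)" "f = Q p"
        by auto
      define p' where "p' = monom c (nat (m + int ?l)) + p"
      have mJ: "m \<ge> - int ?l" "nat (m + int ?l) \<notin> k_idx lam ` {1..?l}"
        using m mem_J_set_shift[OF assms] by auto
      have "p' \<in> ker_conds (conds lam)"
        using p mJ by (auto simp: ker_conds_iff p'_def)
      moreover have "fls_const c * g + f = Q p'"
        using mJ by (intro fls_eqI) (auto simp: m p Q_nth p'_def X_def)
      ultimately show ?case by blast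
    qed
  next
    fix f assume "f \<in> Q ` ker_conds (conds lam)"
    then obtain p where p: "p \<in> ker_conds (conds lam)" "f = Q p" by auto
    have "f = (\<Sum>j\<le>degree p. fls_const (coeff p j) * X (int j - int ?l))"
    proof (intro fls_eqI)
      fix m
      have "fls_nth (\<Sum>j\<le>degree p. fls_const (coeff p j) * X (int j - int ?l)) m
          = (\<Sum>j\<le>degree p. if j = nat (m + int ?l) \<and> m \<ge> - int ?l then coeff p j else 0)"
        by (auto simp: fls_nth_sum X_def intro!: sum.cong)
      also have "\<dots> = fls_nth f m"
        by (auto simp: p Q_nth coeff_eq_0)
      finally show "fls_nth f m = fls_nth (\<Sum>j\<le>degree p. fls_const (coeff p j) * X (int j - int ?l)) m" ..
    qed
    also have "\<dots> \<in> V.span (X ` J_set lam)"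
    proof (intro V.span_sum)
      fix j
      show "fls_const (coeff p j) * X (int j - int ?l) \<in> V.span (X ` J_set lam)"
      proof (cases "coeff p j = 0")
        case False
        then have "int j - int ?l \<in> J_set lam"
          using p by (auto simp: mem_J_set_shift[OF assms] ker_conds_iff)
        then show ?thesis by (intro V.span_scale V.span_base) auto
      qed (simp add: V.span_zero)
    qed
    finally show "f \<in> V.span (X ` J_set lam)" .
  qed
  finally show ?thesis by (auto simp: Q_def X_def)
qed

text \<open>The sum converges in particular for finitely supported \<open>t\<close>, the only case used below.\<close>

definition psi0 :: "(nat \<Rightarrow> complex) \<Rightarrow> complex \<Rightarrow> complex" where
  "psi0 t z = exp (\<Sum>k. t (Suc k) * z ^ Suc k)"

text \<open>The dynamical wave function of the point \<open>q\<^sup>-\<^sup>1 ker (span cs)\<close>.\<close>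

definition wave_function ::
  "((complex \<Rightarrow> complex) \<Rightarrow> complex) list \<Rightarrow> (complex \<Rightarrow> complex) \<Rightarrow> (nat \<Rightarrow> complex) \<Rightarrow> complex \<Rightarrow> complex"
  where
  "wave_function cs q t z =
     (let phis = map (\<lambda>c t. c (psi0 t)) cs in
      wronskian_t1 (phis @ [\<lambda>t. psi0 t z]) t / (q z * wronskian_t1 phis t))"

definition psi_W :: "(nat \<Rightarrow> nat) \<Rightarrow> (nat \<Rightarrow> complex) \<Rightarrow> complex \<Rightarrow> complex" where
  "psi_W lam = wave_function (conds lam) (\<lambda>z. z ^ part_length lam)"

definition Psi :: "(nat \<Rightarrow> nat) \<Rightarrow> complex \<Rightarrow> complex \<Rightarrow> complex \<Rightarrow> complex" where
  "Psi lam x y z = psi_W lam ((\<lambda>_. 0)(1 := x, 2 := y)) z"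

end

theory Submission
  imports Defs
begin

text \<open>A Wronskian is linear in its last entry, with coefficients that depend only on the other
  entries and are applied to derivatives of the last one.  Since every \<open>x\<close>-derivative of
  \<open>exp (x z + y z\<^sup>2) = \<Sum> H\<^sub>n z\<^sup>n / n!\<close> may be taken term by term, the numerator of the wave function is
  the sum of the Wronskians ending in \<open>H\<^sub>n\<close>, weighted by \<open>z\<^sup>n / n!\<close>; those with \<open>n = k\<^sub>i\<close> have two
  equal columns.  With \<open>n = m + \<ell>\<close> the normalisation \<open>\<Prod> (n - k\<^sub>i)\<close> of the exceptional polynomials is
  \<open>\<kappa>(m)\<close>.  The second expansion is the first one times \<open>z\<^sup>N \<tau>\<close>: the factors of \<open>\<kappa>\<^sub>N(m + N)\<close> with
  \<open>i > \<ell>\<close> are \<open>m + i\<close>, and their product is \<open>(m + N)! / (m + \<ell>)!\<close>.\<close>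

section \<open>Wronskians as functions of their list of entries\<close>

text \<open>The entries index columns while \<open>det_permute_rows\<close> acts on rows, hence the
  transposition before and after.\<close>

lemma wronskian_permute_list:
  assumes p: "p permutes {..<length fs}"
  shows "wronskian (permute_list p fs) x = signof p * wronskian fs x"
proof -
  let ?n = "length fs"
  define A where "A = Matrix.mat ?n ?n (\<lambda>(j, i). (deriv ^^ i) (fs ! j) x)"
  have A: "A \<in> carrier_mat ?n ?n" by (simp add: A_def)
  have lt: "p j < ?n" if "j < ?n" for j
    using permutes_in_image[OF p, of j] that by auto
  have "wronskian (permute_list p fs) x =
      det (transpose_mat (Matrix.mat ?n ?n (\<lambda>(j, i). A $$ (p j, i))))"
    unfolding wronskian_def
    by (intro arg_cong[where f = det] eq_matI) (auto simp: A_def lt permute_list_nth[OF p])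
  also have "\<dots> = det (Matrix.mat ?n ?n (\<lambda>(j, i). A $$ (p j, i)))"
    by (rule det_transpose) auto
  also have "\<dots> = signof p * det A"
    using det_permute_rows[OF A] p by (simp add: lessThan_atLeast0)
  also have "det A = det (transpose_mat A)"
    by (rule det_transpose[OF A, symmetric])
  also have "transpose_mat A = Matrix.mat ?n ?n (\<lambda>(i, j). (deriv ^^ i) (fs ! j) x)"
    by (intro eq_matI) (auto simp: A_def)
  finally show ?thesis by (simp add: wronskian_def)
qed

text \<open>The seeds are listed as \<open>k\<^sub>\<ell>, \<dots>, k\<^sub>1\<close> in the Hermite Wronskians but as \<open>k\<^sub>1, \<dots>, k\<^sub>\<ell>\<close> in the wave
  function; the two resulting signs agree, because the reversal fixes the last entry.\<close>

lemma wronskian_rev: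
  obtains s :: complex where "s \<noteq> 0"
    and "\<And>x. wronskian (rev fs) x = s * wronskian fs x"
    and "\<And>g x. wronskian (rev fs @ [g]) x = s * wronskian (fs @ [g]) x"
proof
  let ?n = "length fs"
  \<comment> \<open>The \<open>else\<close> branch lets one permutation, with one sign, act both on
    \<open>fs\<close> and on the list extended by \<open>g\<close>.\<close>
  define p where "p j = (if j < ?n then ?n - Suc j else j)" for j
  have p: "p permutes {..<?n}"
    by (rule bij_imp_permutes, rule bij_betwI[where g = p]) (auto simp: p_def)
  then have p': "p permutes {..<Suc ?n}"
    by (rule permutes_subset) auto
  show "signof p \<noteq> (0 :: complex)"
    using signof_pm_one[of p, where 'a = complex] by auto
  have "rev fs = permute_list p fs"
    by (rule nth_equalityI) (auto simp: permute_list_def p_def rev_nth)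
  then show "wronskian (rev fs) x = signof p * wronskian fs x" for x
    using wronskian_permute_list[OF p] by simp
  have "rev fs @ [g] = permute_list p (fs @ [g])" for g
    by (rule nth_equalityI)
      (auto simp: permute_list_def p_def rev_nth nth_append less_Suc_eq simp del: upt_Suc)
  then show "wronskian (rev fs @ [g]) x = signof p * wronskian (fs @ [g]) x" for g x
    using wronskian_permute_list[of p "fs @ [g]"] p' by simp
qed

text \<open>Laplace expansion along the last column; the point is that \<open>c\<close> is chosen
  before \<open>g\<close>.\<close>

lemma wronskian_append_expansion:
  obtains c where "\<And>g. wronskian (fs @ [g]) x = (\<Sum>i\<le>length fs. c i * (deriv ^^ i) g x)"
proof
  fix g
  let ?n = "length fs"
  define A where
    "A g = Matrix.mat (Suc ?n) (Suc ?n) (\<lambda>(i, j). (deriv ^^ i) ((fs @ [g]) ! j) x)" for g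
  have "wronskian (fs @ [g]) x = (\<Sum>i<Suc ?n. A g $$ (i, ?n) * cofactor (A g) i ?n)"
    using laplace_expansion_column[of "A g" "Suc ?n" ?n] by (simp add: A_def wronskian_def)
  also have "\<dots> = (\<Sum>i\<le>?n. cofactor (A (\<lambda>_. 0)) i ?n * (deriv ^^ i) g x)"
  proof (intro sum.cong)
    fix i assume "i \<in> {..?n}"
    \<comment> \<open>Only the deleted column involves \<open>g\<close>, so the cofactors can be
      computed with the zero function in its place.\<close>
    have "mat_delete (A g) i ?n = mat_delete (A (\<lambda>_. 0)) i ?n"
      by (intro eq_matI) (auto simp: A_def mat_delete_def nth_append)
    then show "A g $$ (i, ?n) * cofactor (A g) i ?n =
        cofactor (A (\<lambda>_. 0)) i ?n * (deriv ^^ i) g x"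
      using \<open>i \<in> {..?n}\<close> by (simp add: cofactor_def A_def)
  qed auto
  finally show "wronskian (fs @ [g]) x =
    (\<Sum>i\<le>?n. cofactor (A (\<lambda>_. 0)) i ?n * (deriv ^^ i) g x)" .
qed

lemma wronskian_append_member:
  assumes "g \<in> set fs"
  shows "wronskian (fs @ [g]) x = 0"
proof -
  obtain j where j: "j < length fs" "fs ! j = g"
    using assms by (auto simp: in_set_conv_nth)
  show ?thesis
    unfolding wronskian_def
    by (rule det_identical_columns[of _ "Suc (length fs)" j "length fs"])
      (use j in \<open>auto simp: nth_append intro!: eq_vecI\<close>)
qed

section \<open>Bivariate Hermite polynomials and their generating function\<close>

text \<open>The Cauchy product of the series of \<open>exp (x * z)\<close> and
  \<open>exp (y * z ^ 2)\<close> makes the polynomial dependence on \<open>x\<close>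
  explicit.\<close>

lemma hermite_eq_sum:
  "hermite n x y =
    fact n * (\<Sum>k\<le>n. x ^ k / fact k * fps_nth (fps_expansion (\<lambda>z. exp (y * z ^ 2)) 0) (n - k))"
proof -
  let ?E = "fps_expansion (\<lambda>z. exp (y * z ^ 2)) 0"
  have "(\<lambda>z. exp (y * z ^ 2)) has_fps_expansion ?E"
    by (rule has_fps_expansion_fps_expansion[of UNIV]) (auto intro!: holomorphic_intros)
  then have "(\<lambda>z. exp (x * z) * exp (y * z ^ 2)) has_fps_expansion fps_exp x * ?E"
    by (intro has_fps_expansion_mult has_fps_expansion_exp)
  then have "fps_expansion (\<lambda>z. exp (x * z + y * z ^ 2)) 0 = fps_exp x * ?E"
    by (simp add: exp_add fps_expansion_eqI)
  then show ?thesis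
    by (simp add: hermite_def fps_mult_nth atMost_atLeast0)
qed

text \<open>The Appell property; at \<open>n = 0\<close> the truncated \<open>n - 1\<close> is
  harmless because of the factor \<open>of_nat n\<close>.\<close>

lemma has_field_derivative_hermite:
  "((\<lambda>x. hermite n x y) has_field_derivative (of_nat n * hermite (n - 1) x y)) (at x)"
proof (cases n)
  case 0
  then show ?thesis by (simp add: hermite_eq_sum)
next
  case (Suc m)
  define E where "E = fps_nth (fps_expansion (\<lambda>z. exp (y * z ^ 2)) 0)"
  have "((\<lambda>x. fact n * (\<Sum>k\<le>n. x ^ k / fact k * E (n - k))) has_field_derivative
      fact n * (\<Sum>k\<le>n. of_nat k * x ^ (k - 1) / fact k * E (n - k))) (at x)"
    by (auto intro!: derivative_eq_intros sum.cong simp: field_simps)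
  also have "(\<Sum>k\<le>n. of_nat k * x ^ (k - 1) / fact k * E (n - k)) =
      (\<Sum>k\<le>m. x ^ k / fact k * E (m - k))"
    \<comment> \<open>The summand at \<open>k = 0\<close> vanishes; in the others
      \<open>k / k!\<close> is \<open>1 / (k - 1)!\<close>.\<close>
    unfolding Suc sum.atMost_Suc_shift
    by (simp add: fact_Suc divide_simps del: of_nat_Suc)
  finally show ?thesis
    by (simp add: hermite_eq_sum E_def Suc mult.assoc del: sum.atMost_Suc)
qed

text \<open>The index \<open>n + i\<close> avoids truncated subtraction; \<open>n\<close> is
  arbitrary because the induction hypothesis is applied at \<open>Suc n\<close>.\<close>

lemma higher_deriv_hermite:
  "(deriv ^^ i) (\<lambda>x. hermite (n + i) x y) = (\<lambda>x. fact (n + i) / fact n * hermite n x y)"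
proof (induction i arbitrary: n)
  case (Suc i)
  have "(deriv ^^ Suc i) (\<lambda>x. hermite (n + Suc i) x y) =
      deriv (\<lambda>x. fact (Suc n + i) / fact (Suc n) * hermite (Suc n) x y)"
    using Suc.IH[of "Suc n"] by simp
  also have "\<dots> = (\<lambda>x. fact (n + Suc i) / fact n * hermite n x y)"
    by (intro ext DERIV_imp_deriv)
      (auto intro!: derivative_eq_intros has_field_derivative_hermite simp: divide_simps
         simp del: of_nat_Suc)
  finally show ?case .
qed simp

lemma higher_deriv_hermite_eq_0:
  assumes "n < i"
  shows "(deriv ^^ i) (\<lambda>x. hermite n x y) = (\<lambda>_. 0)"
  using assms
proof (induction i)
  case (Suc i)
  show ?case
  proof (cases "n = i")
    case True
    then show ?thesis
      using higher_deriv_hermite[of i 0 y] by (simp add: hermite_eq_sum)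
  qed (use Suc in auto)
qed simp

lemma has_sum_hermite:
  "((\<lambda>n. hermite n x y * z ^ n / fact n) has_sum exp (x * z + y * z ^ 2)) UNIV"
proof (rule norm_summable_imp_has_sum[OF _ hermite_generating_function])
  \<comment> \<open>Unordered summation needs absolute convergence, which at \<open>z\<close>
    follows from convergence at the larger radius \<open>norm z + 1\<close>.\<close>
  have "summable (\<lambda>n. hermite n x y / fact n * of_real (norm z + 1) ^ n)"
    using hermite_generating_function[of x y "of_real (norm z + 1)"] by (auto simp: sums_iff)
  then show "summable (\<lambda>n. norm (hermite n x y * z ^ n / fact n))"
    using powser_insidea[of "\<lambda>n. hermite n x y / fact n" "of_real (norm z + 1)" z]
    by (simp add: norm_of_real del: of_real_add)
qed

text \<open>No limit is interchanged with a derivative: by the Appell property, \<open>z ^ i\<close>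
  times the generating series is already the series of \<open>i\<close>-th derivatives, shifted by
  \<open>i\<close>, and the terms with \<open>n < i\<close> vanish.\<close>

lemma has_sum_higher_deriv_hermite:
  "((\<lambda>n. (deriv ^^ i) (\<lambda>x. hermite n x y) x * z ^ n / fact n)
     has_sum z ^ i * exp (x * z + y * z ^ 2)) UNIV"
proof -
  let ?f = "\<lambda>n. (deriv ^^ i) (\<lambda>x. hermite n x y) x * z ^ n / fact n"
  have "((\<lambda>n. z ^ i * (hermite n x y * z ^ n / fact n))
      has_sum z ^ i * exp (x * z + y * z ^ 2)) UNIV"
    by (intro has_sum_cmult_right has_sum_hermite)
  then have "(?f \<circ> (\<lambda>n. n + i) has_sum z ^ i * exp (x * z + y * z ^ 2)) UNIV"
    by (rule has_sum_cong[THEN iffD1, rotated])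
      (simp add: higher_deriv_hermite power_add)
  then have "(?f has_sum z ^ i * exp (x * z + y * z ^ 2)) (range (\<lambda>n. n + i))"
    by (subst has_sum_reindex) auto
  also have "range (\<lambda>n. n + i) = {i..}"
    by (auto simp: image_iff) (metis le_Suc_ex add.commute)
  finally show ?thesis
    by (rule has_sum_cong_neutral[THEN iffD1, rotated -1])
      (auto simp: higher_deriv_hermite_eq_0)
qed

lemma higher_deriv_exp_affine:
  "(deriv ^^ i) (\<lambda>x. exp (x * z + b)) = (\<lambda>x::complex. z ^ i * exp (x * z + b))"
proof (induction i)
  case (Suc i)
  have "deriv (\<lambda>x. z ^ i * exp (x * z + b)) = (\<lambda>x. z ^ Suc i * exp (x * z + b))"
    by (intro ext DERIV_imp_deriv) (auto intro!: derivative_eq_intros)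
  then show ?case by (simp add: Suc)
qed simp

lemma has_sum_sum:
  fixes f :: "'i \<Rightarrow> 'a \<Rightarrow> 'b :: topological_comm_monoid_add"
  assumes "\<And>i. i \<in> I \<Longrightarrow> (f i has_sum s i) A"
  shows "((\<lambda>x. \<Sum>i\<in>I. f i x) has_sum (\<Sum>i\<in>I. s i)) A"
  using assms by (induction I rule: infinite_finite_induct) (auto intro: has_sum_add has_sum_0)

lemma has_sum_wronskian_append_hermite:
  "((\<lambda>n. wronskian (fs @ [\<lambda>x. hermite n x y]) x * z ^ n / fact n)
     has_sum wronskian (fs @ [\<lambda>x. exp (x * z + y * z ^ 2)]) x) UNIV"
proof -
  obtain c where c: "\<And>g. wronskian (fs @ [g]) x = (\<Sum>i\<le>length fs. c i * (deriv ^^ i) g x)"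
    by (rule wronskian_append_expansion) blast
  have "((\<lambda>n. \<Sum>i\<le>length fs. c i * ((deriv ^^ i) (\<lambda>x. hermite n x y) x * z ^ n / fact n))
      has_sum (\<Sum>i\<le>length fs. c i * (z ^ i * exp (x * z + y * z ^ 2)))) UNIV"
    by (intro has_sum_sum has_sum_cmult_right has_sum_higher_deriv_hermite)
  then show ?thesis
    by (simp add: c higher_deriv_exp_affine sum_distrib_right sum_divide_distrib mult.assoc)
qed

section \<open>The wave function at the times x, y, 0, 0, ..\<close>

lemma psi0_two_times:
  "psi0 ((\<lambda>_::nat. 0)(1 := x, 2 := y)) = (\<lambda>z. exp (x * z + y * z ^ 2))"
proof
  fix z
  let ?t = "(\<lambda>_::nat. 0)(1 := x, 2 := y)"
  \<comment> \<open>The exponent is summed over \<open>Suc k\<close>, so the times 1 and 2 sit at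
    \<open>k = 0\<close> and \<open>k = 1\<close>.\<close>
  have "(\<Sum>k. ?t (Suc k) * z ^ Suc k) = (\<Sum>k\<in>{0, 1}. ?t (Suc k) * z ^ Suc k)"
    by (rule suminf_finite) auto
  then show "psi0 ?t z = exp (x * z + y * z ^ 2)" by (simp add: psi0_def power2_eq_square)
qed

lemma Psi_eq_wronskian:
  "Psi lam x y z = wronskian (hermite_seed lam y @ [\<lambda>x. exp (x * z + y * z ^ 2)]) x /
     (z ^ part_length lam * wronskian (hermite_seed lam y) x)"
proof -
  let ?t = "(\<lambda>_::nat. 0)(1 := x, 2 := y)" and ?fs = "hermite_seed lam y"
  have upd: "?t(1 := s) = (\<lambda>_::nat. 0)(1 := s, 2 := y)" for s
    by (simp add: fun_eq_iff)
  \<comment> \<open>The derivative of order \<open>k_idx lam i\<close> at 0 of the generating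
    function is a factorial times a Taylor coefficient, hence a Hermite polynomial.\<close>
  have cond: "cond lam i (psi0 (?t(1 := s))) = hermite (k_idx lam i) s y" for i s
    unfolding upd psi0_two_times by (simp add: cond_def hermite_def fps_expansion_def)
  have phis: "map (\<lambda>f s. f (?t(1 := s))) (map (\<lambda>c t. c (psi0 t)) (conds lam)) = rev ?fs"
    unfolding conds_def map_map hermite_seed_def rev_map rev_rev_ident
    by (intro map_cong[OF refl] ext) (simp only: comp_apply cond)
  have psi: "psi0 (?t(1 := s)) z = exp (s * z + y * z ^ 2)" for s
    unfolding upd psi0_two_times ..
  obtain s where s: "s \<noteq> (0 :: complex)"
    "\<And>x. wronskian (rev ?fs) x = s * wronskian ?fs x"
    "\<And>g x. wronskian (rev ?fs @ [g]) x = s * wronskian (?fs @ [g]) x"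
    by (rule wronskian_rev[of ?fs]) blast
  have "Psi lam x y z = wronskian (rev ?fs @ [\<lambda>x. exp (x * z + y * z ^ 2)]) x /
      (z ^ part_length lam * wronskian (rev ?fs) x)"
    unfolding Psi_def psi_W_def wave_function_def Let_def wronskian_t1_def map_append phis
    by (simp add: psi[simplified])
  \<comment> \<open>The factor \<open>s\<close> occurs in both numerator and denominator and
    cancels.\<close>
  then show ?thesis using s by simp
qed

section \<open>The polynomials kappa, factorials and gaps of the Maya diagram\<close>

lemma partition_eq_0:
  assumes "is_partition lam" "i > part_length lam"
  shows "lam i = 0"
  using part_support[OF assms(1)] assms(2)
  by (metis (mono_tags, lifting) One_nat_def Suc_leI atLeastAtMost_iff gr_implies_not0
      linorder_not_le mem_Collect_eq neq0_conv)

text \<open>The integer is \<open>lam i\<close> plus the nonnegative difference of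
  \<open>part_length lam\<close> and \<open>i\<close>, so \<open>nat\<close> truncates
  nothing.\<close>

lemma int_k_idx:
  assumes "1 \<le> i" "i \<le> part_length lam"
  shows "int (k_idx lam i) = maya lam i + int (part_length lam)"
  using assms by (simp add: k_idx_def maya_def)

text \<open>Each nonzero part contributes at least 1 to the size.\<close>

lemma part_length_le_part_size:
  assumes "is_partition lam"
  shows "part_length lam \<le> part_size lam"
proof -
  have "lam i \<noteq> 0" if "i \<in> {1..part_length lam}" for i
    using that part_support[OF assms] by blast
  then have "(\<Sum>i = 1..part_length lam. 1) \<le> (\<Sum>i = 1..part_length lam. lam i)"
    by (intro sum_mono) (simp add: Suc_leI)
  then show ?thesis
    unfolding part_size_def part_support[OF assms] by simp
qed

lemma kappa_eq_prod_k_idx: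
  "kappa lam m = (\<Prod>i = 1..part_length lam. m + int (part_length lam) - int (k_idx lam i))"
  unfolding kappa_def by (intro prod.cong) (simp_all add: int_k_idx)

lemma prod_times_fact_nat:
  assumes "m \<ge> - int a" "a \<le> b"
  shows "(\<Prod>i = Suc a..b. m + int i) * fact (nat (m + int a)) = fact (nat (m + int b))"
  using assms(2)
proof (induction b rule: dec_induct)
  case (step n)
  have "nat (m + int (Suc n)) = Suc (nat (m + int n))"
    using assms(1) step.hyps by simp
  then have "fact (nat (m + int (Suc n))) = (m + int (Suc n)) * fact (nat (m + int n))"
    using assms(1) step.hyps by (simp add: fact_Suc del: of_nat_Suc)
  then show ?case
    using step by (simp add: mult_ac)
qed simp

lemma kappa_N_eq:
  assumes "is_partition lam"
  shows "kappa_N lam (m + int (part_size lam)) =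
    kappa lam m * (\<Prod>i = Suc (part_length lam)..part_size lam. m + int i)"
proof -
  let ?l = "part_length lam" and ?N = "part_size lam"
  have "{1..?N} = {1..?l} \<union> {Suc ?l..?N}"
    using part_length_le_part_size[OF assms] by auto
  then have "kappa_N lam (m + int ?N) =
      (\<Prod>i = 1..?l. m - maya lam i) * (\<Prod>i = Suc ?l..?N. m - maya lam i)"
    unfolding kappa_N_def by (simp add: prod.union_disjoint algebra_simps)
  also have "(\<Prod>i = Suc ?l..?N. m - maya lam i) = (\<Prod>i = Suc ?l..?N. m + int i)"
    by (intro prod.cong) (auto simp: maya_def partition_eq_0[OF assms])
  finally show ?thesis by (simp add: kappa_def)
qed

lemma kappa_N_div_fact:
  assumes "is_partition lam" "m \<ge> - int (part_length lam)"
  shows "of_int (kappa_N lam (m + int (part_size lam))) / fact (nat (m + int (part_size lam))) =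
    (of_int (kappa lam m) / fact (nat (m + int (part_length lam))) :: complex)"
proof -
  have "(fact (nat (m + int (part_size lam))) :: complex) =
      of_int ((\<Prod>i = Suc (part_length lam)..part_size lam. m + int i) *
        fact (nat (m + int (part_length lam))))"
    using prod_times_fact_nat[OF assms(2) part_length_le_part_size[OF assms(1)]] by simp
  \<comment> \<open>The product divides a factorial, so it is nonzero and may be cancelled.\<close>
  moreover from this have
    "of_int (\<Prod>i = Suc (part_length lam)..part_size lam. m + int i) \<noteq> (0 :: complex)"
    by (metis fact_nonzero mult_zero_left of_int_mult)
  ultimately show ?thesis
    by (simp add: kappa_N_eq[OF assms(1)] del: of_int_prod)
qed

text \<open>From \<open>- int (part_length lam)\<close> upwards, the complement of
  \<open>J_set lam\<close> consists of roots of \<open>kappa lam\<close>.\<close>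

lemma kappa_eq_0:
  assumes "is_partition lam" "m \<ge> - int (part_length lam)" "m \<notin> J_set lam"
  shows "kappa lam m = 0"
proof -
  obtain i where i: "i \<in> {1..part_length lam}"
    and "nat (m + int (part_length lam)) = k_idx lam i"
    using assms by (auto simp: mem_J_set_shift)
  then have "m + int (part_length lam) - int (k_idx lam i) = 0"
    using assms(2) by linarith
  with i show ?thesis
    unfolding kappa_eq_prod_k_idx by (meson finite_atLeastAtMost prod_zero)
qed

lemma kappa_N_eq_0:
  assumes "is_partition lam" "n \<ge> 0" "n \<notin> I_set lam"
  shows "kappa_N lam n = 0"
proof -
  have "n - int (part_size lam) \<notin> J_set lam"
    using assms(3) by (force simp: I_set_def)
  then obtain i where i: "1 \<le> i" "n - int (part_size lam) = maya lam i"
    by (auto simp: J_set_def M_set_def)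
  \<comment> \<open>An \<open>i\<close> beyond the size has \<open>lam i = 0\<close>, which makes
    \<open>n\<close> equal to the size minus \<open>i\<close>, a negative number.\<close>
  have "i \<le> part_size lam"
  proof (rule ccontr)
    assume "\<not> i \<le> part_size lam"
    then have "lam i = 0"
      using part_length_le_part_size[OF assms(1)] partition_eq_0[OF assms(1)] by simp
    then show False
      using i(2) \<open>\<not> i \<le> part_size lam\<close> assms(2) by (simp add: maya_def)
  qed
  with i have "i \<in> {1..part_size lam}" "n - maya lam i - int (part_size lam) = 0"
    by auto
  then show ?thesis
    unfolding kappa_N_def by (meson finite_atLeastAtMost prod_zero)
qed

section \<open>The expansions of the wave function\<close>

lemma has_sum_Psi:
  assumes lam: "is_partition lam" and tau: "tau lam x y \<noteq> 0" and z: "z \<noteq> 0"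
  shows "((\<lambda>m. of_int (kappa lam m) / fact (nat (m + int (part_length lam))) *
      R_fun lam m x y * z powi m) has_sum Psi lam x y z) (J_set lam)"
proof -
  let ?l = "part_length lam" and ?fs = "hermite_seed lam y"
  let ?K = "k_idx lam ` {1..?l}"
  define w where "w = (\<lambda>n. wronskian (?fs @ [\<lambda>x. hermite n x y]) x)"
  define g where "g = (\<lambda>n. w n * z ^ n / fact n / (z ^ ?l * wronskian ?fs x))"
  \<comment> \<open>Division by zero yields zero, so a nonzero \<open>tau\<close> forces both its
    numerator and its denominator to be nonzero.\<close>
  have nz: "wronskian ?fs x \<noteq> 0" "vandermonde_k lam \<noteq> 0"
    using tau by (auto simp: tau_def)
  have "w n = 0" if "n \<in> ?K" for n
    unfolding w_def using that
    by (intro wronskian_append_member) (auto simp: hermite_seed_def)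
  then have g0: "g n = 0" if "n \<in> ?K" for n
    using that by (simp add: g_def)
  have "((\<lambda>n. inverse (z ^ ?l * wronskian ?fs x) * (w n * z ^ n / fact n)) has_sum
      inverse (z ^ ?l * wronskian ?fs x) *
      wronskian (?fs @ [\<lambda>x. exp (x * z + y * z ^ 2)]) x) UNIV"
    unfolding w_def by (intro has_sum_cmult_right has_sum_wronskian_append_hermite)
  then have "(g has_sum Psi lam x y z) UNIV"
    by (simp add: g_def[abs_def] Psi_eq_wronskian divide_inverse mult_ac)
  \<comment> \<open>Dropping the vanishing terms leaves exactly the indices
    \<open>m + int ?l\<close> with \<open>m\<close> in \<open>J_set lam\<close>.\<close>
  then have "(g has_sum Psi lam x y z) (- ?K)"
    by (rule has_sum_cong_neutral[THEN iffD1, rotated -1]) (use g0 in auto)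
  moreover have bij: "bij_betw (\<lambda>m. nat (m + int ?l)) (J_set lam) (- ?K)"
    by (rule bij_betwI[where g = "\<lambda>n. int n - int ?l"]) (auto simp: mem_J_set_shift[OF lam])
  ultimately have "((\<lambda>m. g (nat (m + int ?l))) has_sum Psi lam x y z) (J_set lam)"
    by (simp only: has_sum_reindex_bij_betw[OF bij, of g])
  then show ?thesis
  proof (rule has_sum_cong[THEN iffD1, rotated])
    fix m assume "m \<in> J_set lam"
    then have m: "m + int ?l \<ge> 0" "nat (m + int ?l) \<notin> ?K"
      by (auto simp: mem_J_set_shift[OF lam])
    define r where "r = nat (m + int ?l)"
    have r: "m = int r - int ?l" using m by (simp add: r_def)
    \<comment> \<open>Off \<open>?K\<close> no factor of \<open>kappa lam m\<close> vanishes, so it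
      can be cancelled against the normalisation of \<open>exc_hermite\<close>.\<close>
    have "int r - int (k_idx lam i) \<noteq> 0" if "i \<in> {1..?l}" for i
      using m(2) that unfolding r_def[symmetric] by auto
    then have "kappa lam m \<noteq> 0"
      by (simp add: kappa_eq_prod_k_idx r)
    moreover have "(\<Prod>i = 1..?l. of_int (int r) - of_nat (k_idx lam i)) =
        (of_int (kappa lam m) :: complex)"
      by (simp add: kappa_eq_prod_k_idx r)
    ultimately have "of_int (kappa lam m) * R_fun lam m x y = w r / wronskian ?fs x"
      using nz by (simp add: R_fun_def exc_hermite_def tau_def w_def r)
    moreover have "z powi m = z ^ r / z ^ ?l"
      using z by (simp add: r power_int_diff)
    ultimately show "g (nat (m + int ?l)) = of_int (kappa lam m) / fact (nat (m + int ?l)) *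
        R_fun lam m x y * z powi m"
      by (simp add: g_def r_def[symmetric])
  qed
qed

lemma has_sum_exc_hermite:
  assumes lam: "is_partition lam" and tau: "tau lam x y \<noteq> 0" and z: "z \<noteq> 0"
  shows "((\<lambda>n. of_int (kappa_N lam n) / fact (nat n) * exc_hermite lam n x y * z powi n)
    has_sum (z ^ part_size lam * tau lam x y * Psi lam x y z)) (I_set lam)"
proof -
  let ?N = "part_size lam"
  let ?f = "\<lambda>n. of_int (kappa_N lam n) / fact (nat n) * exc_hermite lam n x y * z powi n"
  have "((\<lambda>m. z ^ ?N * tau lam x y * (of_int (kappa lam m) /
      fact (nat (m + int (part_length lam))) * R_fun lam m x y * z powi m))
    has_sum (z ^ ?N * tau lam x y * Psi lam x y z)) (J_set lam)"
    by (intro has_sum_cmult_right has_sum_Psi assms)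
  then have "(?f \<circ> (\<lambda>m. m + int ?N) has_sum (z ^ ?N * tau lam x y * Psi lam x y z)) (J_set lam)"
  proof (rule has_sum_cong[THEN iffD1, rotated])
    fix m assume "m \<in> J_set lam"
    then have "m \<ge> - int (part_length lam)"
      by (simp add: mem_J_set_shift[OF lam])
    \<comment> \<open>The factor \<open>tau\<close> clears the denominator of \<open>R_fun\<close>;
      as \<open>z\<close> is nonzero, powers add even at negative \<open>m\<close>.\<close>
    then show "z ^ ?N * tau lam x y * (of_int (kappa lam m) /
        fact (nat (m + int (part_length lam))) * R_fun lam m x y * z powi m) =
        (?f \<circ> (\<lambda>m. m + int ?N)) m"
      unfolding comp_def kappa_N_div_fact[OF lam \<open>m \<ge> _\<close>]
      using tau z by (simp add: R_fun_def power_int_add)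
  qed
  then show ?thesis
    unfolding I_set_def by (subst has_sum_reindex) auto
qed


theorem theorem4p10:
  fixes lam :: "nat \<Rightarrow> nat" and N l :: nat and x y z :: complex
  assumes "is_partition lam"
    and "N = part_size lam"
    and "l = part_length lam"
    and "tau lam x y \<noteq> 0"
    and "z \<noteq> 0"
  shows "((\<lambda>m. of_int (kappa lam m) / fact (nat (m + int l)) * R_fun lam m x y * z powi m)
            has_sum Psi lam x y z) (J_set lam)
       \<and> ((\<lambda>m. if m \<in> J_set lam
               then of_int (kappa lam m) / fact (nat (m + int l)) * R_fun lam m x y * z powi m
               else 0)
            has_sum Psi lam x y z) {- int l..}
       \<and> ((\<lambda>n. of_int (kappa_N lam n) / fact (nat n) * exc_hermite lam n x y * z powi n)
            has_sum (z ^ N * tau lam x y * Psi lam x y z)) (I_set lam)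
       \<and> ((\<lambda>n. if n \<in> I_set lam
               then of_int (kappa_N lam n) / fact (nat n) * exc_hermite lam n x y * z powi n
               else 0)
            has_sum (z ^ N * tau lam x y * Psi lam x y z)) {0..}
       \<and> (\<forall>m \<ge> - int l. m \<notin> J_set lam \<longrightarrow> kappa lam m = 0)
       \<and> (\<forall>n \<ge> 0. n \<notin> I_set lam \<longrightarrow> kappa_N lam n = 0)"
proof -
  have J: "J_set lam \<subseteq> {- int l..}"
    using assms(1,3) by (auto simp: mem_J_set_shift)
  have I: "I_set lam \<subseteq> {0..}"
    using J part_length_le_part_size[OF assms(1)] assms(3) by (force simp: I_set_def)
  \<comment> \<open>Padding with zeros reduces the second and fourth sums to the first and
    third.\<close>
  have extend: "((\<lambda>n. if n \<in> A then f n else 0) has_sum s) B \<longleftrightarrow> (f has_sum s) A"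
    if "A \<subseteq> B" for A B :: "int set" and f :: "int \<Rightarrow> complex" and s
    by (rule has_sum_cong_neutral) (use that in auto)
  show ?thesis
    unfolding extend[OF J] extend[OF I]
    using has_sum_Psi[OF assms(1,4,5)] has_sum_exc_hermite[OF assms(1,4,5)]
      kappa_eq_0[OF assms(1)] kappa_N_eq_0[OF assms(1)]
    by (simp add: assms(2,3))
qed

end
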